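(* Any finite simple graph $G$ containing neighbourhood chains of Type 3 (as defined below) is non-distance magic.
   Context: $N(u)=\{v: uv\in E(G)\}$. A bijection $f:V(G)\to\{1,\dots,|V(G)|\}$ is a distance magic labeling if $\sum_{v\in N(u)}f(v)$ is constant over $u\in V(G)$; $G$ is non-distance magic if it has no such labeling. A neighbourhood chain of length $k\ge2$ is a sequence $N_1\cdots N_k$ with $N_i=N(u_i)$, $u_i\in V(G)$, such that $N_i\cap N_{i+1}\ne\emptyset$ for $1\le i\le k-1$ and $N_i\cap N_j=\emptyset$ whenever $|i-j|\ge2$ and $\{i,j\}\ne\{1,k\}$. Type 3 chains: Let $n_1,n_2\ge2$, $n_3\ge\max\{n_1,n_2\}+3$. For $k=1,2,3$ let $V_k=\{u^k_1,\dots,u^k_{n_k}\}\subseteq V(G)$, pairwise disjoint, with $V_1$ and $V_2$ stable sets. For $j=1,2$ and $1\le i\le n_j$ let $N^j_i=N(u^j_i)\subseteq V_3$, $N^j_i\ne\emptyset$, and suppose $NC_j=N^j_1\cdots N^j_{n_j}$ is a neighbourhood chain for $j=1,2$. $NC_1,NC_2$ are Type 3 chains if (i) for $j=1,2$: $N^j_{i+1}\setminus N^j_i\subseteq N^j_{i+2}$ for $i=1,\dots,n_j-2$, and $|N^j_i\setminus N^j_{i+1}|\ge1$, $|N^j_{i+1}\setminus N^j_i|\ge1$ for $i=1,\dots,n_j-1$; (ii) with $q=\min\{n_1,n_2\}$ there exist $1\le i\le n_1-1$, $1\le j\le n_2-1$, $0\le r\le\lfloor q/2\rfloor-1$ with $N^2_j\setminus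 N^2_{j+1}\subseteq N^1_i\setminus N^1_{i+1}$, $N^1_{i+1+2r}\setminus N^1_{i+2r}\subseteq N^2_{j+1+2r}\setminus N^2_{j+2r}$, and $|(N^1_i\setminus N^1_{i+1})\setminus(N^2_j\setminus N^2_{j+1})|+|(N^2_{j+1+2r}\setminus N^2_{j+2r})\setminus(N^1_{i+1+2r}\setminus N^1_{i+2r})|\ge1$. *)

theory Defs
  imports "Graph_Theory.Digraph" "HOL-Library.Disjoint_Sets"
begin

text \<open>
  Finite simple graphs are the locale \<^locale>\<open>graph\<close>: finite symmetric digraphs without loops and
  parallel arcs.  An edge \<open>uv\<close> is a pair of opposite arcs, so adjacency is the
  relation \<^const>\<open>dominates\<close>.
\<close>

definition nbhd :: "('a, 'b) pre_digraph \<Rightarrow> 'a \<Rightarrow> 'a set" where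
  "nbhd G u = {v. u \<rightarrow>\<^bsub>G\<^esub> v}"

definition stable_set :: "('a, 'b) pre_digraph \<Rightarrow> 'a set \<Rightarrow> bool" where
  "stable_set G S \<longleftrightarrow> S \<subseteq> verts G \<and> (\<forall>u\<in>S. \<forall>v\<in>S. \<not> u \<rightarrow>\<^bsub>G\<^esub> v)"

definition distance_magic_labeling :: "('a, 'b) pre_digraph \<Rightarrow> ('a \<Rightarrow> nat) \<Rightarrow> bool" where
  "distance_magic_labeling G f \<longleftrightarrow>
     bij_betw f (verts G) {1..card (verts G)} \<and>
     (\<exists>c. \<forall>u\<in>verts G. (\<Sum>v\<in>nbhd G u. f v) = c)"

definition non_distance_magic :: "('a, 'b) pre_digraph \<Rightarrow> bool" where
  "non_distance_magic G \<longleftrightarrow> \<not> (\<exists>f. distance_magic_labeling G f)"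

text \<open>Sequences are functions on \<^typ>\<open>nat\<close> of which only the values at \<open>1, \<dots>, k\<close> matter.\<close>

definition nbhd_chain :: "('a, 'b) pre_digraph \<Rightarrow> nat \<Rightarrow> (nat \<Rightarrow> 'a set) \<Rightarrow> bool" where
  "nbhd_chain G k N \<longleftrightarrow>
     2 \<le> k \<and>
     (\<forall>i\<in>{1..k}. \<exists>u\<in>verts G. N i = nbhd G u) \<and>
     (\<forall>i\<in>{1..k-1}. N i \<inter> N (i+1) \<noteq> {}) \<and>
     (\<forall>i\<in>{1..k}. \<forall>j\<in>{1..k}.
        2 \<le> \<bar>int i - int j\<bar> \<and> {i, j} \<noteq> {1, k} \<longrightarrow> N i \<inter> N j = {})"

text \<open>
  The families are given by \<open>n k\<close> (the number of vertices of \<open>V k\<close>) and \<open>u k i\<close> (the \<open>i\<close>-th vertex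
  of \<open>V k\<close>) for \<open>k = 1, 2, 3\<close>; the listed vertices are distinct.  The conditions
  \<open>i+1+2*r \<le> n 1\<close> and \<open>j+1+2*r \<le> n 2\<close> state that the neighbourhoods with these
  indices are members of the two chains.
\<close>

definition type3_chains ::
  "('a, 'b) pre_digraph \<Rightarrow> (nat \<Rightarrow> nat) \<Rightarrow> (nat \<Rightarrow> nat \<Rightarrow> 'a) \<Rightarrow> bool" where
  "type3_chains G n u \<longleftrightarrow>
    (let V = (\<lambda>k. u k ` {1..n k});
         N = (\<lambda>j i. nbhd G (u j i));
         q = min (n 1) (n 2)
     in
       2 \<le> n 1 \<and> 2 \<le> n 2 \<and> max (n 1) (n 2) + 3 \<le> n 3 \<and>
       (\<forall>k\<in>{1, 2, 3}. V k \<subseteq> verts G \<and> inj_on (u k) {1..n k}) \<and>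
       disjoint_family_on V {1, 2, 3} \<and>
       stable_set G (V 1) \<and> stable_set G (V 2) \<and>
       (\<forall>j\<in>{1, 2}. \<forall>i\<in>{1..n j}. N j i \<subseteq> V 3 \<and> N j i \<noteq> {}) \<and>
       (\<forall>j\<in>{1, 2}. nbhd_chain G (n j) (N j)) \<and>
       (\<forall>j\<in>{1, 2}.
          (\<forall>i\<in>{1..n j - 2}. N j (i+1) - N j i \<subseteq> N j (i+2)) \<and>
          (\<forall>i\<in>{1..n j - 1}. 1 \<le> card (N j i - N j (i+1)) \<and> 1 \<le> card (N j (i+1) - N j i))) \<and>
       (\<exists>i\<in>{1..n 1 - 1}. \<exists>j\<in>{1..n 2 - 1}. \<exists>r\<in>{0..q div 2 - 1}.
          i+1+2*r \<le> n 1 \<and> j+1+2*r \<le> n 2 \<and>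
          N 2 j - N 2 (j+1) \<subseteq> N 1 i - N 1 (i+1) \<and>
          N 1 (i+1+2*r) - N 1 (i+2*r) \<subseteq> N 2 (j+1+2*r) - N 2 (j+2*r) \<and>
          1 \<le> card ((N 1 i - N 1 (i+1)) - (N 2 j - N 2 (j+1)))
             + card ((N 2 (j+1+2*r) - N 2 (j+2*r)) - (N 1 (i+1+2*r) - N 1 (i+2*r)))))"

end

(* In a distance magic labelling all neighbourhoods have the same weight c.  Along a chain with
   N(i+1) - N(i) contained in N(i+2), the weight of N(i+1) - N(i) therefore alternates between two
   values a and c - a.  So N(i) - N(i+1) and N(i+1+2r) - N(i+2r) have the same weight in each chain,
   and the two opposite inclusions between the chains force these weights to agree in both chains.
   As labels are positive, both inclusions are equalities. *)
theory Submission
  imports Defs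
begin

lemma sum_diff_eq_sum_diff:
  fixes f :: "'a \<Rightarrow> 'b::cancel_comm_monoid_add"
  assumes "finite A" "finite B" "sum f A = sum f B"
  shows "sum f (A - B) = sum f (B - A)"
proof -
  have "sum f (A \<inter> B) + sum f (A - B) = sum f (B \<inter> A) + sum f (B - A)"
    using assms by (simp flip: sum.Int_Diff)
  then show ?thesis
    by (simp add: Int_commute)
qed

text \<open>The two inclusions give \<open>B - C = B \<inter> A\<close>. As \<open>B\<close> and
  \<open>C\<close> weigh the same, \<open>C - B\<close> weighs as much as
  \<open>B \<inter> A\<close>, which is just what \<open>B - A\<close> lacks of
  \<open>B\<close>.\<close>

lemma sum_consecutive_diffs:
  fixes f :: "'a \<Rightarrow> 'b::cancel_comm_monoid_add"
  assumes fin: "finite B" "finite C" and eq: "sum f B = sum f C"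
    and "A \<inter> C = {}" "B - A \<subseteq> C"
  shows "sum f (B - A) + sum f (C - B) = sum f B"
proof -
  have "B - C = B \<inter> A"
    using assms(4,5) by blast
  then have "sum f (C - B) = sum f (B \<inter> A)"
    using sum_diff_eq_sum_diff[OF fin eq] by simp
  then show ?thesis
    using sum.Int_Diff[OF fin(1), of f A] by (simp add: add.commute)
qed

lemma sum_diff_chain_periodic:
  fixes f :: "'a \<Rightarrow> nat" and N :: "nat \<Rightarrow> 'a set"
  assumes fin: "\<And>l. i \<le> l \<Longrightarrow> l \<le> i + 1 + 2 * r \<Longrightarrow> finite (N l)"
    and eq: "\<And>l. i \<le> l \<Longrightarrow> l \<le> i + 1 + 2 * r \<Longrightarrow> sum f (N l) = c"
    and disj: "\<And>l. i \<le> l \<Longrightarrow> l + 2 \<le> i + 1 + 2 * r \<Longrightarrow> N l \<inter> N (l + 2) = {}"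
    and sub: "\<And>l. i \<le> l \<Longrightarrow> l + 2 \<le> i + 1 + 2 * r \<Longrightarrow> N (l + 1) - N l \<subseteq> N (l + 2)"
  shows "sum f (N (i + 1 + 2 * r) - N (i + 2 * r)) = sum f (N i - N (i + 1))"
proof -
  have step: "sum f (N (l + 1) - N l) + sum f (N (l + 2) - N (l + 1)) = c"
    if "i \<le> l" "l + 2 \<le> i + 1 + 2 * r" for l
    using that sum_consecutive_diffs[of "N (l + 1)" "N (l + 2)" f "N l"] disj[of l] sub[of l]
    by (simp add: fin eq)
  \<comment> \<open>Two consecutive instances of \<open>step\<close> share their middle difference;
    cancelling it moves the index by two.\<close>
  have "sum f (N (i + 1 + 2 * s) - N (i + 2 * s)) = sum f (N (i + 1) - N i)" if "s \<le> r" for s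
    using that
  proof (induction s)
    case (Suc s)
    then show ?case
      using step[of "i + 2 * s"] step[of "i + 2 * s + 1"] by (simp add: add_ac)
  qed simp
  \<comment> \<open>The induction compares forward differences only; the first one is now turned
    around, which keeps its weight because \<open>N i\<close> and \<open>N (i + 1)\<close> weigh the
    same.\<close>
  then show ?thesis
    using sum_diff_eq_sum_diff[of "N (i + 1)" "N i" f] by (simp add: fin eq)
qed

lemma nbhd_chain_sum_diff:
  fixes f :: "'a \<Rightarrow> nat"
  assumes chain: "nbhd_chain G k N"
    and sub: "\<forall>i\<in>{1..k - 2}. N (i + 1) - N i \<subseteq> N (i + 2)"
    and fin: "\<forall>i\<in>{1..k}. finite (N i)"
    and sum_nbhd: "\<forall>u\<in>verts G. sum f (nbhd G u) = c"
    and ir: "1 \<le> i" "i + 1 + 2 * r \<le> k"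
  shows "sum f (N (i + 1 + 2 * r) - N (i + 2 * r)) = sum f (N i - N (i + 1))"
proof (rule sum_diff_chain_periodic[where c = c])
  fix l
  assume l: "i \<le> l"
  {
    assume "l \<le> i + 1 + 2 * r"
    then have "l \<in> {1..k}" using l ir by simp
    then show "finite (N l)" "sum f (N l) = c"
      using fin sum_nbhd chain unfolding nbhd_chain_def by fastforce+
  }
  assume l2: "l + 2 \<le> i + 1 + 2 * r"
  show "N (l + 1) - N l \<subseteq> N (l + 2)"
    using sub l l2 ir by simp
  \<comment> \<open>The two ends of the chain may meet, but for \<open>k = 3\<close> only \<open>r = 0\<close> is possible.\<close>
  have "{l, l + 2} \<noteq> {1, k}"
    using l l2 ir by (auto simp: doubleton_eq_iff)
  then show "N l \<inter> N (l + 2) = {}"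
    using chain l l2 ir unfolding nbhd_chain_def by auto
qed

text \<open>The weights form a closed circle: A' \<le> A = D' \<le> D = A'. So nothing is lost in
  either inclusion, and with positive weights a proper subset would lose something.\<close>

lemma opposite_inclusions_equal:
  fixes f :: "'a \<Rightarrow> nat"
  assumes "finite A" "finite D" "A' \<subseteq> A" "D' \<subseteq> D"
    and "sum f A = sum f D'" "sum f A' = sum f D"
    and pos: "\<And>x. x \<in> A \<union> D \<Longrightarrow> 0 < f x"
  shows "A' = A" "D' = D"
proof -
  have "sum f A' \<le> sum f A" "sum f D' \<le> sum f D"
    using assms(1-4) by (simp_all add: sum_mono2)
  then have eq: "sum f A' = sum f A" "sum f D' = sum f D"
    using assms by linarith+
  have *: "T = S" if "finite S" "T \<subseteq> S" "sum f T = sum f S" "\<And>x. x \<in> S \<Longrightarrow> 0 < f x" for S T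
    using that sum_strict_mono2[of S T _ f] by (metis DiffI less_irrefl subsetI subset_antisym zero_le)
  show "A' = A" "D' = D"
    using *[OF assms(1,3) eq(1)] *[OF assms(2,4) eq(2)] pos by simp_all
qed

theorem theorem3p5:
  fixes G :: "('a, 'b) pre_digraph"
  assumes "graph G"
    and "\<exists>n u. type3_chains G n u"
  shows "non_distance_magic G"
  unfolding non_distance_magic_def
proof
  assume "\<exists>f. distance_magic_labeling G f"
  then obtain f c where bij: "bij_betw f (verts G) {1..card (verts G)}"
    and c: "\<forall>u\<in>verts G. sum f (nbhd G u) = c"
    unfolding distance_magic_labeling_def by blast
  obtain n u where t3: "type3_chains G n u"
    using assms(2) by blast
  define N where "N = (\<lambda>j i. nbhd G (u j i))"
  interpret graph G by fact
  \<comment> \<open>Labels start at 1, which rules out the value 0 of type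
    \<open>nat\<close>.\<close>
  have pos: "0 < f x" if "x \<in> verts G" for x
    using bij_betwE[OF bij] that by fastforce
  have sub: "N j i \<subseteq> verts G" for j i
    unfolding N_def nbhd_def by auto
  then have fin: "finite (N j i)" for j i
    using finite_verts finite_subset by blast
  obtain i j r where ijr: "1 \<le> i" "1 \<le> j" "i + 1 + 2 * r \<le> n 1" "j + 1 + 2 * r \<le> n 2"
    "N 2 j - N 2 (j + 1) \<subseteq> N 1 i - N 1 (i + 1)"
    "N 1 (i + 1 + 2 * r) - N 1 (i + 2 * r) \<subseteq> N 2 (j + 1 + 2 * r) - N 2 (j + 2 * r)"
    "1 \<le> card ((N 1 i - N 1 (i + 1)) - (N 2 j - N 2 (j + 1)))
       + card ((N 2 (j + 1 + 2 * r) - N 2 (j + 2 * r)) - (N 1 (i + 1 + 2 * r) - N 1 (i + 2 * r)))"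
    using t3 unfolding type3_chains_def Let_def N_def by auto
  have chain: "nbhd_chain G (n k) (N k)" "\<forall>l\<in>{1..n k - 2}. N k (l + 1) - N k l \<subseteq> N k (l + 2)"
    if "k \<in> {1, 2}" for k
    using t3 that unfolding type3_chains_def Let_def N_def by blast+
  have sums: "sum f (N k (l + 1 + 2 * r) - N k (l + 2 * r)) = sum f (N k l - N k (l + 1))"
    if "k \<in> {1, 2}" "1 \<le> l" "l + 1 + 2 * r \<le> n k" for k l
    using nbhd_chain_sum_diff[OF chain[OF that(1)] _ c that(2,3)] fin by blast
  have pos_diff: "0 < f x" if "x \<in> (N 1 i - N 1 (i + 1)) \<union> (N 2 (j + 1 + 2 * r) - N 2 (j + 2 * r))" for x
    using that sub by (blast intro: pos)
  have sums12:
    "sum f (N 1 i - N 1 (i + 1)) = sum f (N 1 (i + 1 + 2 * r) - N 1 (i + 2 * r))"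
    "sum f (N 2 j - N 2 (j + 1)) = sum f (N 2 (j + 1 + 2 * r) - N 2 (j + 2 * r))"
    using sums[of 1 i] sums[of 2 j] ijr(1-4) by simp_all
  \<comment> \<open>Here \<open>A\<close> and \<open>D'\<close> come from the first chain,
    \<open>A'\<close> and \<open>D\<close> from the second. Equality in both inclusions makes both
    cardinalities in \<open>ijr(7)\<close> zero.\<close>
  note opposite_inclusions_equal[OF _ _ ijr(5,6) sums12 pos_diff]
  then show False
    using ijr(7) fin by simp
qed

end
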